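(* If $G$ is a connected graph with at least $5$ vertices and $\mu_5(G)=4$, then $$\mu_6(G)=\begin{cases}5 & \text{if } G=K_6,\\ 2+\sqrt{7} & \text{otherwise,}\end{cases}$$ where $K_6$ is the complete graph on $6$ vertices.
   Context: All graphs are finite, undirected, simple and connected. The distance matrix $\mathcal{D}(G)$ of a graph $G$ on vertices $1,\dots,n$ is the $n\times n$ matrix whose $(i,j)$ entry is the length of a shortest path from $i$ to $j$. A real number $\lambda$ is a Pareto eigenvalue of a real $n\times n$ matrix $A$ if there is a nonzero vector $\mathbf{x}\in\mathbb{R}^n$, $\mathbf{x}\ge 0$ (entrywise), with $A\mathbf{x}\ge\lambda\mathbf{x}$ (entrywise) and $\lambda=\frac{\mathbf{x}^TA\mathbf{x}}{\mathbf{x}^T\mathbf{x}}$. The distance Pareto eigenvalues of $G$ are the Pareto eigenvalues of $\mathcal{D}(G)$. $\mu_k(G)$ denotes the $k$-th smallest element of the set of distinct distance Pareto eigenvalues of $G$.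
   Formalization: The case "G = K_6" is replaced by "G = K_n for some n ≥ 6", since μ_5(K_n) = 4 and μ_6(K_n) = 5 for all n ≥ 6; and G = K_5 is excluded, since it has μ_5 = 4 but only five distance Pareto eigenvalues, so μ_6 does not exist. *)

theory Defs
  imports "HOL-Analysis.Analysis" "Graph_Theory.Graph_Theory"
begin

text \<open>
  A finite simple undirected graph is a \<open>pair_graph\<close>: a symmetric, loop-free set of ordered pairs.
  Its vertex set is all of a finite type \<open>'n\<close>, so that matrices indexed by vertices have type
  \<open>real ^ 'n ^ 'n\<close>.
\<close>

text \<open>Length of a shortest path; for unconnected \<open>u\<close>, \<open>v\<close> the value is unspecified.\<close>

definition graph_dist :: "'a pair_pre_digraph \<Rightarrow> 'a \<Rightarrow> 'a \<Rightarrow> nat" where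
  "graph_dist G u v = (LEAST k. \<exists>p. pre_digraph.apath (with_proj G) u p v \<and> length p = k)"

definition distance_matrix :: "('n::finite) pair_pre_digraph \<Rightarrow> real ^ 'n ^ 'n" where
  "distance_matrix G = (\<chi> i j. real (graph_dist G i j))"

text \<open>The order on \<open>real ^ 'n\<close> is entrywise.\<close>

definition pareto_eigenvalue :: "real ^ 'n ^ ('n::finite) \<Rightarrow> real \<Rightarrow> bool" where
  "pareto_eigenvalue A l \<longleftrightarrow>
     (\<exists>x :: real ^ 'n. x \<noteq> 0 \<and> 0 \<le> x \<and> l *\<^sub>R x \<le> A *v x \<and> l = (x \<bullet> (A *v x)) / (x \<bullet> x))"

text \<open>
  The \<open>k\<close>-th smallest element, counting from 1, as a relation: it fails for every \<open>x\<close> if \<open>S\<close> has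
  fewer than \<open>k\<close> elements. Finiteness is required since the cardinality of an infinite set is 0.
\<close>

definition kth_smallest :: "nat \<Rightarrow> real set \<Rightarrow> real \<Rightarrow> bool" where
  "kth_smallest k S x \<longleftrightarrow> x \<in> S \<and> finite {y \<in> S. y < x} \<and> card {y \<in> S. y < x} + 1 = k"

text \<open>\<open>mu_is k G x\<close> says that \<open>\<mu>\<^sub>k(G)\<close> exists and equals \<open>x\<close>.\<close>

definition mu_is :: "nat \<Rightarrow> ('n::finite) pair_pre_digraph \<Rightarrow> real \<Rightarrow> bool" where
  "mu_is k G x \<longleftrightarrow> kth_smallest k {l. pareto_eigenvalue (distance_matrix G) l} x"

end

theory Submission
  imports Defs
begin

text \<open>
  The support \<open>S\<close> of a Pareto eigenvector of a nonnegative matrix carries a positive eigenvector of the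
  principal submatrix on \<open>S\<close>, and conversely. So the distance Pareto eigenvalues of \<open>K\<^sub>n\<close> are
  \<open>0, \<dots>, n - 1\<close>. If \<open>G\<close> is not complete, two vertices at distance 2 and a common neighbour already
  give \<open>0\<close>, \<open>1\<close>, \<open>2\<close> and \<open>1 + sqrt 3\<close>; as \<open>\<mu>\<^sub>5(G) = 4\<close>, there is no eigenvalue in \<open>[3, 4)\<close>. This
  excludes distance 3 (eigenvalue 3), triples with distances 1, 2, 2 (eigenvalue \<open>(1 + sqrt 33) / 2\<close>)
  and induced \<open>K\<^bsub>1,1,2\<^esub>\<close> (eigenvalue \<open>(3 + sqrt 17) / 2\<close>). By the first two, non-adjacency is an
  equivalence relation, by the third it has only two classes, so \<open>G\<close> is complete bipartite. Having
  at least 5 vertices it contains \<open>K\<^bsub>1,3\<^esub>\<close>, whence \<open>2 + sqrt 7\<close>, and the \<open>2 \<times> 2\<close> quotient of a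
  complete bipartite distance matrix leaves no eigenvalue strictly between 4 and \<open>2 + sqrt 7\<close>.
\<close>

section \<open>Distances as lengths of shortest walks\<close>

text \<open>Excising closed subwalks never lengthens a walk. So distances, defined through paths,
  are also minima over walks, which can be extended without checking for repeated vertices.\<close>

lemma (in wf_digraph) awalk_imp_apath_le:
  assumes "awalk u p v"
  shows "\<exists>q. apath u q v \<and> length q \<le> length p"
  using assms
proof (induction p rule: awalk_to_apath_induct)
  case (path p)
  then show ?case by (auto simp: apath_def)
next
  case (decomp p q r s)
  then have "p = q @ r @ s" by (auto dest: awalk_cyc_decomp_has_prop simp: awalk_cyc_decomp_def)
  then show ?case using decomp by auto
qed

context pair_wf_digraph
begin

lemma graph_dist_le:
  assumes "awalk u p v"
  shows "graph_dist G u v \<le> length p"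
proof -
  obtain q where "apath u q v" "length q \<le> length p"
    using awalk_imp_apath_le[OF assms] by auto
  moreover have "graph_dist G u v \<le> length q"
    unfolding graph_dist_def by (rule Least_le) (use calculation in auto)
  ultimately show ?thesis by simp
qed

lemma graph_dist_attained:
  assumes "u \<rightarrow>\<^sup>*\<^bsub>with_proj G\<^esub> v"
  shows "\<exists>p. awalk u p v \<and> length p = graph_dist G u v"
proof -
  obtain p where "awalk u p v" using assms reachable_awalk by auto
  then obtain q where "apath u q v" using awalk_imp_apath_le by blast
  then have "\<exists>k q. apath u q v \<and> length q = k" by blast
  from LeastI_ex[OF this] show ?thesis
    unfolding graph_dist_def apath_def by blast
qed

lemma graph_dist_eq_0_iff:
  assumes "u \<rightarrow>\<^sup>*\<^bsub>with_proj G\<^esub> v"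
  shows "graph_dist G u v = 0 \<longleftrightarrow> u = v"
proof
  assume "graph_dist G u v = 0"
  then show "u = v"
    using graph_dist_attained[OF assms] by (auto simp: awalk_Nil_iff)
next
  assume "u = v"
  then have "awalk u [] v" using assms by (auto simp: awalk_Nil_iff reachable_in_verts)
  from graph_dist_le[OF this] show "graph_dist G u v = 0" by simp
qed

text \<open>The first arc of a shortest walk leads to \<open>w\<close>. A walk from \<open>w\<close>
  to \<open>v\<close> with fewer than \<open>k\<close> arcs would, after that arc, beat the distance
  from \<open>u\<close>.\<close>

lemma graph_dist_Suc:
  assumes "u \<rightarrow>\<^sup>*\<^bsub>with_proj G\<^esub> v" "graph_dist G u v = Suc k"
  shows "\<exists>w. (u, w) \<in> parcs G \<and> graph_dist G w v = k"
proof -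
  obtain p where p: "awalk u p v" "length p = Suc k"
    using graph_dist_attained[OF assms(1)] assms(2) by auto
  then obtain e q where "p = e # q" by (cases p) auto
  then obtain w where w: "(u, w) \<in> parcs G" "awalk w q v" "length q = k"
    using p by (cases e) (auto simp: awalk_Cons_iff)
  then obtain r where r: "awalk w r v" "length r = graph_dist G w v"
    using graph_dist_attained reachable_awalk by blast
  then have "awalk u ((u, w) # r) v" using w by (auto simp: awalk_Cons_iff)
  from graph_dist_le[OF this] have "Suc k \<le> Suc (length r)" using assms(2) by simp
  moreover have "graph_dist G w v \<le> k" using graph_dist_le w by blast
  ultimately show ?thesis using w r by auto
qed

end

lemma (in pair_sym_digraph) graph_dist_commute:
  "graph_dist G u v = graph_dist G v u"
proof -
  have "(\<exists>p. apath u p v \<and> length p = k) \<longleftrightarrow> (\<exists>p. apath v p u \<and> length p = k)" for k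
  proof -
    have len: "length (rev_path p) = length p" for p :: "('a \<times> 'a) list"
      by (induction p) auto
    show ?thesis by (metis len apath_rev_path)
  qed
  then show ?thesis unfolding graph_dist_def by simp
qed

lemma (in pair_wf_digraph) graph_dist_eq_1_iff:
  assumes "u \<rightarrow>\<^sup>*\<^bsub>with_proj G\<^esub> v" "u \<noteq> v"
  shows "graph_dist G u v = 1 \<longleftrightarrow> (u, v) \<in> parcs G"
proof
  assume "graph_dist G u v = 1"
  then obtain p where "awalk u p v" "length p = 1"
    using graph_dist_attained[OF assms(1)] by auto
  then show "(u, v) \<in> parcs G" by (cases p) (auto simp: awalk_simps)
next
  assume "(u, v) \<in> parcs G"
  then have "awalk u [(u, v)] v" by (auto simp: awalk_simps intro: wellformed')
  from graph_dist_le[OF this] show "graph_dist G u v = 1"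
    using graph_dist_eq_0_iff[OF assms(1)] assms(2) by simp
qed

section \<open>Pareto eigenvalues through positive eigenvectors of principal submatrices\<close>

text \<open>Complementary slackness: the Rayleigh quotient condition says that the nonnegative terms
  \<open>x_i * ((A x)_i - l * x_i)\<close> sum to 0, so the rows of the support hold with equality.
  Conversely, a positive eigenvector on \<open>S\<close> is extended by 0.\<close>

lemma pareto_eigenvalue_iff_support:
  fixes A :: "real ^ ('n::finite) ^ 'n"
  assumes nonneg: "\<And>i j. 0 \<le> A $ i $ j"
  shows "pareto_eigenvalue A l \<longleftrightarrow>
    (\<exists>S f. S \<noteq> {} \<and> (\<forall>i\<in>S. 0 < f i) \<and> (\<forall>i\<in>S. (\<Sum>j\<in>S. A $ i $ j * f j) = l * f i))"
    (is "_ \<longleftrightarrow> ?R")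
proof
  assume "pareto_eigenvalue A l"
  then obtain x :: "real ^ 'n" where x: "x \<noteq> 0" "0 \<le> x" "l *\<^sub>R x \<le> A *v x"
    and l: "l = (x \<bullet> (A *v x)) / (x \<bullet> x)"
    unfolding pareto_eigenvalue_def by blast
  define S where "S = {i. x $ i \<noteq> 0}"
  have ge: "0 \<le> x $ i" "l * x $ i \<le> (A *v x) $ i" for i
    using x(2,3) by (auto simp: less_eq_vec_def)
  have "x \<bullet> (A *v x) = l * (x \<bullet> x)" using l x(1) by simp
  then have "(\<Sum>i\<in>UNIV. x $ i * ((A *v x) $ i - l * x $ i)) = 0"
    by (simp add: inner_vec_def sum_distrib_left algebra_simps sum_subtractf)
  then have "\<forall>i\<in>UNIV. x $ i * ((A *v x) $ i - l * x $ i) = 0"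
    by (subst (asm) sum_nonneg_eq_0_iff) (auto intro!: mult_nonneg_nonneg simp: ge)
  then have eq: "(A *v x) $ i = l * x $ i" if "i \<in> S" for i
    using that by (auto simp: S_def)
  have "(A *v x) $ i = (\<Sum>j\<in>S. A $ i $ j * x $ j)" for i
    unfolding matrix_vector_mult_def
    by (auto simp: S_def intro!: sum.mono_neutral_right)
  moreover have "S \<noteq> {}" using x(1) by (auto simp: S_def vec_eq_iff)
  moreover have "\<forall>i\<in>S. 0 < x $ i" using ge(1) by (auto simp: S_def less_le)
  ultimately show ?R using eq by (intro exI[of _ S] exI[of _ "\<lambda>i. x $ i"]) auto
next
  assume ?R
  then obtain S f where S: "S \<noteq> {}" "\<And>i. i \<in> S \<Longrightarrow> 0 < f i"
    and eq: "\<And>i. i \<in> S \<Longrightarrow> (\<Sum>j\<in>S. A $ i $ j * f j) = l * f i" by blast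
  define x :: "real ^ 'n" where "x = (\<chi> i. if i \<in> S then f i else 0)"
  have xi: "x $ i = (if i \<in> S then f i else 0)" for i by (simp add: x_def)
  have Ax: "(A *v x) $ i = (\<Sum>j\<in>S. A $ i $ j * f j)" for i
    unfolding matrix_vector_mult_def
    by (auto simp: xi if_distrib intro!: sum.mono_neutral_cong_right)
  have x0: "x \<noteq> 0" using S by (auto simp: vec_eq_iff xi) (metis less_irrefl)
  have "x \<bullet> (A *v x) = (\<Sum>i\<in>UNIV. x $ i * (l * x $ i))"
    unfolding inner_vec_def by (rule sum.cong) (auto simp: xi Ax eq)
  also have "\<dots> = l * (x \<bullet> x)" by (simp add: inner_vec_def sum_distrib_left algebra_simps)
  finally have "l = (x \<bullet> (A *v x)) / (x \<bullet> x)" using x0 by simp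
  moreover have "0 \<le> x" using S by (auto simp: less_eq_vec_def xi less_imp_le)
  \<comment> \<open>Off \<open>S\<close> the required inequality is just
    \<open>0 <= (A x)_i\<close>; this is where the nonnegative entries matter.\<close>
  moreover have "0 \<le> (A *v x) $ i" for i
    unfolding Ax by (intro sum_nonneg mult_nonneg_nonneg nonneg less_imp_le[OF S(2)])
  then have "l *\<^sub>R x \<le> A *v x"
    using eq Ax by (auto simp: less_eq_vec_def xi)
  ultimately show "pareto_eigenvalue A l" unfolding pareto_eigenvalue_def using x0 by blast
qed

lemma pareto_eigenvalue_distance_matrix_iff:
  "pareto_eigenvalue (distance_matrix G) l \<longleftrightarrow>
    (\<exists>S f. S \<noteq> {} \<and> (\<forall>i\<in>S. 0 < f i) \<and>
      (\<forall>i\<in>S. (\<Sum>j\<in>S. real (graph_dist G i j) * f j) = l * f i))"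
  by (subst pareto_eigenvalue_iff_support) (auto simp: distance_matrix_def)

section \<open>Spectrum of complete graphs\<close>

text \<open>Row \<open>i\<close> says that the total weight of \<open>S\<close> is
  \<open>(l + 1) * f i\<close>; summing over \<open>S\<close> forces \<open>l + 1 = card S\<close>.
  Constant weights on sets of every size give the converse.\<close>

lemma pareto_complete:
  assumes d: "\<And>i j. graph_dist G i j = (if i = j then 0 else 1)"
  shows "{l. pareto_eigenvalue (distance_matrix (G :: ('n::finite) pair_pre_digraph)) l}
     = real ` {..<CARD('n)}" (is "?L = ?R")
proof -
  have sum: "(\<Sum>j\<in>S. real (graph_dist G i j) * f j) = sum f S - f i" if "i \<in> S" for S i f
  proof -
    have "(\<Sum>j\<in>S. real (graph_dist G i j) * f j) = (\<Sum>j\<in>S - {i}. f j)"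
      by (rule sum.mono_neutral_cong_right) (auto simp: d)
    then show ?thesis using that by (simp add: sum_diff1)
  qed
  show ?thesis
  proof (intro equalityI subsetI)
    fix l assume "l \<in> ?L"
    then obtain S f where S: "S \<noteq> {}" "\<And>i. i \<in> S \<Longrightarrow> 0 < f i"
      and l: "\<And>i. i \<in> S \<Longrightarrow> (\<Sum>j\<in>S. real (graph_dist G i j) * f j) = l * f i"
      unfolding mem_Collect_eq pareto_eigenvalue_distance_matrix_iff by metis
    have eq: "sum f S = (l + 1) * f i" if "i \<in> S" for i
      using l[OF that] sum[OF that, of f] by (simp add: algebra_simps)
    have pos: "0 < sum f S" using S by (intro sum_pos) auto
    have "(l + 1) * sum f S = (\<Sum>i\<in>S. (l + 1) * f i)" by (simp add: sum_distrib_left)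
    also have "\<dots> = (\<Sum>i\<in>S. sum f S)" using eq by (intro sum.cong) auto
    also have "\<dots> = real (card S) * sum f S" by simp
    finally have "l + 1 = real (card S)" using pos by simp
    moreover have "1 \<le> card S" using S by (simp add: Suc_le_eq card_gt_0_iff)
    moreover have "card S \<le> CARD('n)" by (simp add: card_mono)
    ultimately show "l \<in> ?R" by (intro image_eqI[of _ _ "card S - 1"]) auto
  next
    fix l assume "l \<in> ?R"
    then obtain k where k: "k < CARD('n)" "l = real k" by auto
    then obtain S :: "'n set" where S: "card S = Suc k"
      using obtain_subset_with_card_n[of "Suc k" "UNIV :: 'n set"] by auto
    then have "S \<noteq> {}" by auto
    then have "S \<noteq> {} \<and> (\<forall>i\<in>S. 0 < (1::real)) \<and>
        (\<forall>i\<in>S. (\<Sum>j\<in>S. real (graph_dist G i j) * 1) = l * 1)"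
      using sum[of _ S "\<lambda>_. 1"] S k by simp
    then show "l \<in> ?L"
      unfolding mem_Collect_eq pareto_eigenvalue_distance_matrix_iff
      by (intro exI[of _ S] exI[of _ "\<lambda>_. 1"])
  qed
qed

section \<open>The eigenvalue gap of complete bipartite graphs\<close>

text \<open>\<open>P\<close> and \<open>Q\<close> are the two classes within the support of an
  eigenvector. Summing the rows over each class leaves a 2 x 2 system for the totals
  \<open>s\<close> and \<open>t\<close>. Its solvability is one equation in \<open>l\<close> and the
  class sizes, and the bounds on \<open>l\<close> leave few sizes to check.\<close>

lemma complete_bipartite_eigenvalue_eq_4:
  fixes f :: "'a \<Rightarrow> real"
  assumes fin: "finite P" "finite Q" and ne: "P \<union> Q \<noteq> {}"
    and pos: "\<And>i. i \<in> P \<union> Q \<Longrightarrow> 0 < f i"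
    and P: "\<And>i. i \<in> P \<Longrightarrow> 2 * (sum f P - f i) + sum f Q = l * f i"
    and Q: "\<And>i. i \<in> Q \<Longrightarrow> sum f P + 2 * (sum f Q - f i) = l * f i"
    and l: "4 \<le> l" "l < 2 + sqrt 7"
  shows "l = 4"
proof -
  define p q where "p = card P" and "q = card Q"
  define s t where "s = sum f P" and "t = sum f Q"
  have s: "(l + 2) * s = p * (2 * s + t)"
  proof -
    have "(l + 2) * s = (\<Sum>i\<in>P. (l + 2) * f i)" by (simp add: s_def sum_distrib_left)
    also have "\<dots> = (\<Sum>i\<in>P. 2 * s + t)"
      using P by (intro sum.cong) (auto simp: s_def t_def algebra_simps)
    finally show ?thesis by (simp add: p_def)
  qed
  have t: "(l + 2) * t = q * (s + 2 * t)"
  proof -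
    have "(l + 2) * t = (\<Sum>i\<in>Q. (l + 2) * f i)" by (simp add: t_def sum_distrib_left)
    also have "\<dots> = (\<Sum>i\<in>Q. s + 2 * t)"
      using Q by (intro sum.cong) (auto simp: s_def t_def algebra_simps)
    finally show ?thesis by (simp add: q_def)
  qed
  have s_pos: "0 < s" if "p \<noteq> 0" unfolding s_def
    by (rule sum_pos) (use that fin pos in \<open>auto simp: p_def\<close>)
  have t_pos: "0 < t" if "q \<noteq> 0" unfolding t_def
    by (rule sum_pos) (use that fin pos in \<open>auto simp: q_def\<close>)
  have s0: "s = 0" if "p = 0" using that fin by (simp add: p_def s_def)
  have t0: "t = 0" if "q = 0" using that fin by (simp add: q_def t_def)
  have pq: "p \<noteq> 0 \<or> q \<noteq> 0" using ne fin by (auto simp: p_def q_def)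
  have "sqrt 7 < 3" by (rule real_less_lsqrt) auto
  then have l5: "l < 5" using l by simp
  \<comment> \<open>The upper bound becomes linear in \<open>l\<close> and \<open>l * l\<close>;
    equality in \<open>u\<close> would be the equation for the star with three leaves.\<close>
  have "(l - 2)\<^sup>2 < (sqrt 7)\<^sup>2" using l by (intro power_strict_mono) auto
  then have u: "l * l < 3 + 4 * l" by (simp add: power2_eq_square algebra_simps)
  have w: "4 * l \<le> l * l" using l by (intro mult_right_mono) auto
  have s': "(l + 2 - 2 * p) * s = p * t" and t': "(l + 2 - 2 * q) * t = q * s"
    using s t by (auto simp: algebra_simps)
  consider "p = 0" "q \<noteq> 0" | "q = 0" "p \<noteq> 0" | "p \<noteq> 0" "q \<noteq> 0" using pq by auto
  then show ?thesis
  proof cases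
    case 1
    then have "l + 2 = 2 * q" using t' s0 t_pos by auto
    \<comment> \<open>Here \<open>4 <= l < 5\<close> gives \<open>6 <= 2 * q < 7\<close>.\<close>
    moreover from this have "q = 3" using l l5 by linarith
    ultimately show ?thesis by simp
  next
    case 2
    then have "l + 2 = 2 * p" using s' t0 s_pos by auto
    moreover from this have "p = 3" using l l5 by linarith
    ultimately show ?thesis by simp
  next
    case 3
    then have st: "0 < s" "0 < t" using s_pos t_pos by auto
    \<comment> \<open>Positive totals force both factors to be positive, and \<open>l < 5\<close>
      then leaves at most 3 vertices in each class.\<close>
    have "0 < (l + 2 - 2 * p) * s" "0 < (l + 2 - 2 * q) * t" unfolding s' t' using st 3 by auto
    then have "2 * p < l + 2" "2 * q < l + 2" using st by (auto simp: zero_less_mult_iff)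
    then have "p \<le> 3" "q \<le> 3" using l5 by linarith+
    then have cases: "p \<in> {1, 2, 3}" "q \<in> {1, 2, 3}" using 3 by auto
    have "((l + 2 - 2 * p) * (l + 2 - 2 * q)) * (s * t) = (real p * real q) * (s * t)"
      using arg_cong2[OF s' t', of "(*)"] by (simp add: algebra_simps)
    then have "(l + 2 - 2 * p) * (l + 2 - 2 * q) = real p * real q"
      using st by simp
    then have e: "l * l + 4 * l + 4 + 3 * (real p * real q) = (2 * l + 4) * real p + (2 * l + 4) * real q"
      by (simp add: algebra_simps)
    \<comment> \<open>With \<open>m\<close> for the square, each of the nine pairs of sizes gives a
      system linear in \<open>l\<close> and \<open>m\<close>; only sizes 2 and 2 survive.\<close>
    define m where "m = l * l"
    have "p = 2 \<and> q = 2 \<and> m = 4 * l"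
      using cases e u w l unfolding m_def[symmetric] by (auto simp: algebra_simps)
    then show ?thesis using l by (auto simp: m_def)
  qed
qed

section \<open>Eigenvalues of small distance patterns\<close>

context
  fixes G :: "('n::finite) pair_pre_digraph"
  assumes d_self: "\<And>u. graph_dist G u u = 0"
    and d_commute: "\<And>u v. graph_dist G u v = graph_dist G v u"
begin

lemma pareto_0: "pareto_eigenvalue (distance_matrix G) 0"
  unfolding pareto_eigenvalue_distance_matrix_iff
  by (rule exI[of _ "{undefined}"], rule exI[of _ "\<lambda>_. 1"]) (simp add: d_self)

lemma pareto_2_points:
  assumes "u \<noteq> v"
  shows "pareto_eigenvalue (distance_matrix G) (real (graph_dist G u v))"
  unfolding pareto_eigenvalue_distance_matrix_iff
  by (rule exI[of _ "{u, v}"], rule exI[of _ "\<lambda>_. 1"])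
    (use assms in \<open>simp add: d_self d_commute[of v u]\<close>)

text \<open>As \<open>c\<close> is equidistant from \<open>a\<close> and \<open>b\<close>, a vector
  with entries 1, 1, \<open>t\<close> is tried; the last two assumptions are its rows at
  \<open>a\<close> and \<open>c\<close>.\<close>

lemma pareto_3_points:
  assumes "distinct [a, b, c]" and "0 < t"
    and "graph_dist G a c = graph_dist G b c"
    and "real (graph_dist G a b) + real (graph_dist G a c) * t = l"
    and "2 * real (graph_dist G a c) = l * t"
  shows "pareto_eigenvalue (distance_matrix G) l"
  unfolding pareto_eigenvalue_distance_matrix_iff
  by (rule exI[of _ "{a, b, c}"], rule exI[of _ "\<lambda>i. if i = c then t else 1"])
    (use assms in \<open>auto simp: d_self d_commute[of b a] d_commute[of c a] d_commute[of c b]\<close>)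

lemma pareto_K12:
  assumes "distinct [a, b, c]"
    and "graph_dist G a b = 2" "graph_dist G a c = 1" "graph_dist G b c = 1"
  shows "pareto_eigenvalue (distance_matrix G) (1 + sqrt 3)"
proof (rule pareto_3_points[of a b c])
  \<comment> \<open>The positive root of \<open>t * (2 + t) = 2\<close>.\<close>
  show "0 < sqrt 3 - 1" by simp
  show "2 * real (graph_dist G a c) = (1 + sqrt 3) * (sqrt 3 - 1)"
    using assms by (simp add: algebra_simps)
qed (use assms in auto)

lemma pareto_1_2_2:
  assumes "distinct [a, b, c]"
    and "graph_dist G a b = 1" "graph_dist G a c = 2" "graph_dist G b c = 2"
  shows "pareto_eigenvalue (distance_matrix G) ((1 + sqrt 33) / 2)"
proof (rule pareto_3_points[of a b c])
  \<comment> \<open>The positive root of \<open>t * (1 + 2 * t) = 4\<close>.\<close>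
  show "0 < (sqrt 33 - 1) / 4" by simp
  show "2 * real (graph_dist G a c) = (1 + sqrt 33) / 2 * ((sqrt 33 - 1) / 4)"
    using assms by (simp add: algebra_simps)
qed (use assms in \<open>auto simp: field_simps\<close>)

lemma pareto_K112:
  assumes "distinct [a, b, c, e]"
    and "graph_dist G a b = 2" "graph_dist G c e = 1"
    and "graph_dist G a c = 1" "graph_dist G a e = 1" "graph_dist G b c = 1" "graph_dist G b e = 1"
  shows "pareto_eigenvalue (distance_matrix G) ((3 + sqrt 17) / 2)"
  unfolding pareto_eigenvalue_distance_matrix_iff
proof (intro exI conjI)
  \<comment> \<open>The weight \<open>t\<close> of \<open>c\<close> and \<open>e\<close> solves
    \<open>2 + 2 * t = l\<close> and \<open>2 + t = l * t\<close>, the rows at \<open>a\<close> and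
    \<open>c\<close>.\<close>
  define f where "f i = (if i \<in> {c, e} then (sqrt 17 - 1) / 4 else 1)" for i
  show "\<forall>i\<in>{a, b, c, e}. 0 < f i" by (auto simp: f_def)
  show "\<forall>i\<in>{a, b, c, e}. (\<Sum>j\<in>{a, b, c, e}. real (graph_dist G i j) * f j)
      = (3 + sqrt 17) / 2 * f i"
    using assms d_commute[of b a] d_commute[of c a] d_commute[of e a] d_commute[of c b]
      d_commute[of e b] d_commute[of e c]
    by (auto simp: f_def d_self field_simps)
qed simp

lemma pareto_K13:
  assumes "distinct [a, b, c, e]"
    and "graph_dist G a b = 2" "graph_dist G a c = 2" "graph_dist G b c = 2"
    and "graph_dist G a e = 1" "graph_dist G b e = 1" "graph_dist G c e = 1"
  shows "pareto_eigenvalue (distance_matrix G) (2 + sqrt 7)"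
  unfolding pareto_eigenvalue_distance_matrix_iff
proof (intro exI conjI)
  \<comment> \<open>The weight \<open>t\<close> of the centre \<open>e\<close> solves
    \<open>4 + t = l\<close> (row of a leaf) and \<open>3 = l * t\<close> (row of the
    centre).\<close>
  define f where "f i = (if i = e then sqrt 7 - 2 else 1)" for i
  have "2 < sqrt 7" by (rule real_less_rsqrt) simp
  then show "\<forall>i\<in>{a, b, c, e}. 0 < f i" by (auto simp: f_def)
  show "\<forall>i\<in>{a, b, c, e}. (\<Sum>j\<in>{a, b, c, e}. real (graph_dist G i j) * f j)
      = (2 + sqrt 7) * f i"
    using assms d_commute[of b a] d_commute[of c a] d_commute[of e a] d_commute[of c b]
      d_commute[of e b] d_commute[of e c]
    by (auto simp: f_def d_self algebra_simps)
qed simp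

text \<open>The support \<open>S\<close> splits into \<open>S \<inter> P\<close> and
  \<open>S - P\<close>, at distance 2 within a part and 1 across, which yields the system of
  \<open>complete_bipartite_eigenvalue_eq_4\<close>.\<close>

lemma pareto_complete_bipartite_eq_4:
  assumes d: "\<And>u v. graph_dist G u v = (if u = v then 0 else if u \<in> P \<longleftrightarrow> v \<in> P then 2 else 1)"
    and "pareto_eigenvalue (distance_matrix G) l" "4 \<le> l" "l < 2 + sqrt 7"
  shows "l = 4"
proof -
  obtain S f where S: "S \<noteq> {}" "\<And>i. i \<in> S \<Longrightarrow> 0 < f i"
    and eq: "\<And>i. i \<in> S \<Longrightarrow> (\<Sum>j\<in>S. real (graph_dist G i j) * f j) = l * f i"
    using assms(2) unfolding pareto_eigenvalue_distance_matrix_iff by metis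
  have split: "(\<Sum>j\<in>S. real (graph_dist G i j) * f j) =
      (\<Sum>j\<in>S \<inter> P. real (graph_dist G i j) * f j) + (\<Sum>j\<in>S - P. real (graph_dist G i j) * f j)" for i
    by (rule sum.Int_Diff) simp
  have same: "(\<Sum>j\<in>T. real (graph_dist G i j) * f j) = 2 * (sum f T - f i)"
    if "i \<in> T" "\<And>j. j \<in> T \<Longrightarrow> (i \<in> P \<longleftrightarrow> j \<in> P)" for T i
  proof -
    have "(\<Sum>j\<in>T. real (graph_dist G i j) * f j) = (\<Sum>j\<in>T - {i}. 2 * f j)"
      using that(2) by (intro sum.mono_neutral_cong_right) (auto simp: d)
    then show ?thesis using that(1) by (simp add: sum_diff1 flip: sum_distrib_left)
  qed
  have other: "(\<Sum>j\<in>T. real (graph_dist G i j) * f j) = sum f T"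
    if "\<And>j. j \<in> T \<Longrightarrow> (i \<in> P \<longleftrightarrow> j \<notin> P)" for T i
    using that by (intro sum.cong) (auto simp: d)
  show ?thesis
  proof (rule complete_bipartite_eigenvalue_eq_4)
    fix i assume "i \<in> S \<inter> P"
    then show "2 * (sum f (S \<inter> P) - f i) + sum f (S - P) = l * f i"
      using eq[of i] split[of i] same[of i "S \<inter> P"] other[of "S - P" i] by auto
  next
    fix i assume "i \<in> S - P"
    then show "sum f (S \<inter> P) + 2 * (sum f (S - P) - f i) = l * f i"
      using eq[of i] split[of i] same[of i "S - P"] other[of "S \<inter> P" i] by auto
  qed (use S assms in auto)
qed

section \<open>From the spectral gap to the complete bipartite structure\<close>

text \<open>\<open>P\<close> is the non-adjacency class of \<open>p\<close>, and \<open>w\<close>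
  shows that the other class is nonempty. An edge outside \<open>P\<close> would form an induced
  \<open>K_{1,1,2}\<close> with the non-adjacent \<open>p\<close> and \<open>q\<close> in
  \<open>P\<close>.\<close>

lemma complete_bipartite_if_no_pareto_between_3_4:
  assumes no: "\<And>l. 3 \<le> l \<Longrightarrow> l < 4 \<Longrightarrow> \<not> pareto_eigenvalue (distance_matrix G) l"
    and step: "\<And>u v k. graph_dist G u v = Suc k \<Longrightarrow> \<exists>w. graph_dist G u w = 1 \<and> graph_dist G w v = k"
    and d0: "\<And>u v. graph_dist G u v = 0 \<Longrightarrow> u = v"
    and p: "p \<noteq> q" "graph_dist G p q \<noteq> 1"
  shows "\<exists>P w. p \<in> P \<and> w \<notin> P \<and>
    (\<forall>u v. graph_dist G u v = (if u = v then 0 else if u \<in> P \<longleftrightarrow> v \<in> P then 2 else 1))"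
proof -
  let ?d = "graph_dist G"
  have le2: "?d u v \<le> 2" for u v
  proof (rule ccontr)
    assume "\<not> ?d u v \<le> 2"
    \<comment> \<open>Following a shortest path towards \<open>v\<close> lowers the distance by one
      at a time, so it meets the value 3 exactly.\<close>
    moreover have "n \<ge> 3 \<Longrightarrow> ?d u v = n \<Longrightarrow> \<exists>w. ?d w v = 3" for n u
    proof (induction n arbitrary: u rule: dec_induct)
      case base
      then show ?case by auto
    next
      case (step n)
      then show ?case using assms(2) by blast
    qed
    ultimately obtain w where "?d w v = 3" by (metis not_less_eq_eq numeral_2_eq_2 numeral_3_eq_3)
    moreover from this have "w \<noteq> v" using d_self[of v] by auto
    ultimately show False using pareto_2_points[of w v] no[of 3] by simp
  qed
  \<comment> \<open>These bounds place \<open>(1 + sqrt 33) / 2\<close> and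
    \<open>(3 + sqrt 17) / 2\<close> strictly between 3 and 4.\<close>
  have "5 < sqrt 33" "sqrt 33 < 7" "3 < sqrt 17" "sqrt 17 < 5"
    by (auto intro: real_less_rsqrt real_less_lsqrt)
  then have no122: False
    if "distinct [a, b, c]" "?d a b = 1" "?d a c = 2" "?d b c = 2" for a b c
    using pareto_1_2_2[OF that] no[of "(1 + sqrt 33) / 2"] by simp
  have noK112: False
    if "distinct [a, b, c, e]" "?d a b = 2" "?d c e = 1"
      "?d a c = 1" "?d a e = 1" "?d b c = 1" "?d b e = 1" for a b c e
    using pareto_K112[OF that] no[of "(3 + sqrt 17) / 2"] \<open>3 < sqrt 17\<close> \<open>sqrt 17 < 5\<close> by simp
  have ne1: "?d u v = (if u = v then 0 else 2)" if "?d u v \<noteq> 1" for u v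
    using that le2[of u v] d0[of u v] d_self by (auto simp: le_Suc_eq numeral_2_eq_2)
  have trans: "?d u w \<noteq> 1" if "?d u v \<noteq> 1" "?d v w \<noteq> 1" for u v w
  proof
    assume 1: "?d u w = 1"
    then have "distinct [u, w, v]" using that d_self d_commute by auto
    then show False
      using no122[of u w v] 1 ne1[OF that(1)] ne1[OF that(2)] d_commute[of w v] by auto
  qed
  \<comment> \<open>\<open>p\<close> itself belongs to \<open>P\<close>, its distance to itself
    being 0.\<close>
  define P where "P = {u. ?d p u \<noteq> 1}"
  have pq: "?d p q = 2" using ne1[of p q] p by simp
  then obtain w where w: "?d p w = 1" using step[of p q 1] by auto
  have adj: "?d u v = 1" if "u \<in> P" "v \<notin> P" for u v
    using that trans[of p u v] by (auto simp: P_def)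
  have "?d u v = (if u = v then 0 else if u \<in> P \<longleftrightarrow> v \<in> P then 2 else 1)" for u v
  proof (cases "u \<in> P \<longleftrightarrow> v \<in> P")
    case True
    have "?d u v \<noteq> 1"
    proof (cases "u \<in> P")
      case True
      then show ?thesis using \<open>u \<in> P \<longleftrightarrow> v \<in> P\<close> trans[of u p v] d_commute[of u p] by (auto simp: P_def)
    next
      case False
      have q: "q \<in> P" "p \<in> P" using pq d_self by (auto simp: P_def)
      show ?thesis
      proof
        assume 1: "?d u v = 1"
        have "u \<noteq> v" using 1 d_self by auto
        then show False
          using noK112[of p q u v] 1 False \<open>u \<in> P \<longleftrightarrow> v \<in> P\<close> q adj pq p by auto
      qed
    qed
    then show ?thesis using ne1[of u v] True by simp
  next
    case False
    then show ?thesis using adj[of u v] adj[of v u] d_commute[of u v] by auto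
  qed
  moreover have "p \<in> P" "w \<notin> P" using w d_self by (auto simp: P_def)
  ultimately show ?thesis by blast
qed

end

section \<open>The sixth eigenvalue\<close>

text \<open>\<open>K_5\<close> has only the eigenvalues 0 to 4, so \<open>\<mu>_6\<close> does not
  exist there. Every \<open>K_n\<close> with \<open>n >= 6\<close> has \<open>\<mu>_5 = 4\<close>
  and \<open>\<mu>_6 = 5\<close>, so the first case covers all of these and not \<open>K_6\<close>
  alone.\<close>

theorem theorem5p1:
  fixes G :: "('n::finite) pair_pre_digraph"
  assumes "pair_graph G"
    and "pverts G = UNIV"
    and "Digraph_Component.connected (with_proj G)"
    and "card (pverts G) \<ge> 5"
    and "mu_is 5 G 4"
    and "\<not> K\<^bsub>5\<^esub> (with_proj G)"
  shows "mu_is 6 G (if \<exists>n\<ge>6. K\<^bsub>n\<^esub> (with_proj G) then 5 else 2 + sqrt 7)"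
proof -
  interpret pair_graph G by fact
  let ?d = "graph_dist G"
  define E where "E = {l. pareto_eigenvalue (distance_matrix G) l}"
  have mu5: "4 \<in> E" "finite {y \<in> E. y < 4}" "card {y \<in> E. y < 4} = 4"
    using assms(5) by (auto simp: mu_is_def kth_smallest_def E_def)
  \<comment> \<open>\<open>connected\<close> means strong connectivity of the symmetric closure,
    which has the same reachability when the arcs are already symmetric.\<close>
  have reach: "u \<rightarrow>\<^sup>*\<^bsub>with_proj G\<^esub> v" for u v
    using assms(2,3) by (auto simp: connected_def strongly_connected_def reachable_mk_symmetric_eq[OF pair_sym_arcs])
  have d0: "?d u v = 0 \<longleftrightarrow> u = v" for u v using graph_dist_eq_0_iff[OF reach] .
  have d1: "?d u v = 1 \<longleftrightarrow> (u, v) \<in> parcs G" for u v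
    using graph_dist_eq_1_iff[OF reach, of u v] d0[of u v] no_loops'[of u v] by auto
  have step: "\<exists>w. ?d u w = 1 \<and> ?d w v = k" if "?d u v = Suc k" for u v k
    using graph_dist_Suc[OF reach that] d1 by blast
  have self: "?d u u = 0" for u using d0 by simp
  note dist_facts = self graph_dist_commute
  have complete: "K\<^bsub>n\<^esub> (with_proj G) \<longleftrightarrow> n = CARD('n) \<and> (\<forall>u v. u \<noteq> v \<longrightarrow> ?d u v = 1)" for n
    using assms(2) no_loops' by (auto simp: complete_digraph_pair_def d1[unfolded One_nat_def])
  show ?thesis
  proof (cases "\<forall>u v. u \<noteq> v \<longrightarrow> ?d u v = 1")
    case True
    then have n6: "6 \<le> CARD('n)"
      using assms(2,4,6) complete[of 5] by auto
    then have K: "\<exists>n\<ge>6. K\<^bsub>n\<^esub> (with_proj G)" using complete True by blast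
    have "E = real ` {..<CARD('n)}"
      unfolding E_def by (rule pareto_complete) (use True self in auto)
    then have "{y \<in> E. y < 5} = real ` {..<5}" "5 \<in> E"
      using n6 by (force, force intro: image_eqI[of _ _ 5])
    moreover have "card (real ` {..<5}) = 5" by (subst card_image) auto
    ultimately show ?thesis using K by (simp add: mu_is_def kth_smallest_def E_def)
  next
    case False
    then have nK: "\<not> (\<exists>n\<ge>6. K\<^bsub>n\<^esub> (with_proj G))" using complete by blast
    obtain p q where pq: "p \<noteq> q" "?d p q \<noteq> 1" using False by blast
    then obtain k where "?d p q = Suc (Suc k)"
      using d0 by (metis One_nat_def not0_implies_Suc)
    have "\<exists>a b. ?d a b = 2" if "?d a b = Suc (Suc k)" for a b k
      using that
    proof (induction k arbitrary: a)
      case 0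
      then show ?case by (auto simp: numeral_2_eq_2)
    next
      case (Suc k)
      then show ?case using step by blast
    qed
    then obtain a b where ab: "?d a b = 2" using \<open>?d p q = Suc (Suc k)\<close> by blast
    then obtain c where c: "?d a c = 1" "?d c b = 1" using step[of a b 1] by auto
    have dist: "distinct [a, b, c]" using ab c self by auto
    have "sqrt 3 < 2" "1 < sqrt 3" "2 < sqrt 7"
      by (auto intro: real_less_rsqrt real_less_lsqrt)
    have "{0, 1, 2, 1 + sqrt 3} \<subseteq> E"
      using pareto_0[OF dist_facts] pareto_2_points[OF dist_facts, of a b]
        pareto_2_points[OF dist_facts, of a c] pareto_K12[OF dist_facts dist ab c(1)]
        dist ab c graph_dist_commute[of b c]
      by (simp add: E_def)
    then have sub: "{0, 1, 2, 1 + sqrt 3} \<subseteq> {y \<in> E. y < 4}" using \<open>sqrt 3 < 2\<close> by auto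
    have "0 \<noteq> 1 + sqrt 3" "2 \<noteq> 1 + sqrt 3" using \<open>1 < sqrt 3\<close> by linarith+
    \<comment> \<open>Exactly four eigenvalues lie below 4, so these four distinct ones are all of
      them.\<close>
    then have "card {0, 1, 2, 1 + sqrt 3} = 4" by (simp add: card_insert_if)
    then have low: "{0, 1, 2, 1 + sqrt 3} = {y \<in> E. y < 4}"
      using card_subset_eq[OF mu5(2) sub] mu5(3) by simp
    have no: "\<not> pareto_eigenvalue (distance_matrix G) l" if "3 \<le> l" "l < 4" for l
    proof
      assume "pareto_eigenvalue (distance_matrix G) l"
      then have "l \<in> {0, 1, 2, 1 + sqrt 3}" using that unfolding low E_def by simp
      then show False using that \<open>sqrt 3 < 2\<close> by auto
    qed
    have "\<exists>P w. p \<in> P \<and> w \<notin> P \<and>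
        (\<forall>u v. ?d u v = (if u = v then 0 else if u \<in> P \<longleftrightarrow> v \<in> P then 2 else 1))"
      by (rule complete_bipartite_if_no_pareto_between_3_4[OF dist_facts no step iffD1[OF d0] pq])
    then obtain P w where P: "p \<in> P" "w \<notin> P"
      and d: "\<forall>u v. ?d u v = (if u = v then 0 else if u \<in> P \<longleftrightarrow> v \<in> P then 2 else 1)"
      by (elim exE conjE)
    note d = d[rule_format]
    have K13: "2 + sqrt 7 \<in> E" if T: "3 \<le> card T" "e \<notin> T" "\<And>u. u \<in> T \<Longrightarrow> u \<in> P \<longleftrightarrow> e \<notin> P" for T e
    proof -
      obtain U where "U \<subseteq> T" "card U = 3" using obtain_subset_with_card_n[OF T(1)] by metis
      then obtain x y z where "U = {x, y, z}" "distinct [x, y, z]"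
        unfolding card_3_iff by auto
      then have "distinct [x, y, z]" "{x, y, z} \<subseteq> T" using \<open>U \<subseteq> T\<close> by auto
      moreover from this have "distinct [x, y, z, e]" using \<open>U \<subseteq> T\<close> T(2) by auto
      ultimately show ?thesis
        using T(3)[of x] T(3)[of y] T(3)[of z] pareto_K13[OF dist_facts, of x y z e]
        by (auto simp: E_def d)
    qed
    have "card P + card (- P) = CARD('n)"
      by (subst card_Un_disjoint[symmetric]) auto
    \<comment> \<open>Of at least five vertices, some class contains three; they are the leaves of a
      star centred at \<open>w\<close> or \<open>p\<close> in the other class.\<close>
    then have "3 \<le> card P \<or> 3 \<le> card (- P)" using assms(2,4) by auto
    then have mem: "2 + sqrt 7 \<in> E" using K13[of P w] K13[of "- P" p] P by auto
    have "l = 4" if "l \<in> E" "4 \<le> l" "l < 2 + sqrt 7" for l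
      using pareto_complete_bipartite_eq_4[OF dist_facts d] that by (simp add: E_def)
    \<comment> \<open>The four eigenvalues below 4 and 4 itself precede \<open>2 + sqrt 7\<close>,
      which is therefore the sixth.\<close>
    then have "{y \<in> E. y < 2 + sqrt 7} = insert 4 {y \<in> E. y < 4}"
      using mu5(1) \<open>2 < sqrt 7\<close> by force
    then have "finite {y \<in> E. y < 2 + sqrt 7}" "card {y \<in> E. y < 2 + sqrt 7} = 5"
      using mu5 by auto
    then show ?thesis unfolding if_not_P[OF nK] using mem by (simp add: mu_is_def kth_smallest_def E_def)
  qed
qed

end
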